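(* Every graph that is bipartite and whose complement is a circular arc graph is a Stick graph.
   Context: A circular arc graph is the intersection graph of a family of arcs of a circle. A Stick graph is the intersection graph of a set of vertical segments and a set of horizontal segments in the plane whose bottom endpoints (vertical ones) and left endpoints (horizontal ones) lie on a fixed line of slope $-1$. *)

theory Defs
  imports "HOL-Complex_Analysis.Contour_Integration" "Graph_Theory.Pair_Digraph"
begin

text \<open>
  A finite simple graph is an instance of \<open>pair_graph\<close>: \<open>parcs\<close> is a symmetric irreflexive relation
  on the finite set \<open>pverts\<close>.
\<close>

definition bipartite :: "'a pair_pre_digraph \<Rightarrow> bool" where
  "bipartite G \<longleftrightarrow> (\<exists>X Y. pverts G = X \<union> Y \<and> X \<inter> Y = {} \<and>
     (\<forall>(u, v) \<in> parcs G. (u \<in> X \<and> v \<in> Y) \<or> (u \<in> Y \<and> v \<in> X)))"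

definition complement_graph :: "'a pair_pre_digraph \<Rightarrow> 'a pair_pre_digraph" where
  "complement_graph G = \<lparr> pverts = pverts G,
     parcs = {(u, v). u \<in> pverts G \<and> v \<in> pverts G \<and> u \<noteq> v \<and> (u, v) \<notin> parcs G} \<rparr>"

definition intersection_graph :: "'a set \<Rightarrow> ('a \<Rightarrow> 'b set) \<Rightarrow> 'a pair_pre_digraph" where
  "intersection_graph V S = \<lparr> pverts = V,
     parcs = {(u, v). u \<in> V \<and> v \<in> V \<and> u \<noteq> v \<and> S u \<inter> S v \<noteq> {}} \<rparr>"

text \<open>
  A closed arc of positive length on the circle with centre \<open>z\<close> and radius \<open>r\<close>; for \<open>t - s \<ge> 2 * pi\<close>
  it is the whole circle.
\<close>

definition circle_arc :: "complex \<Rightarrow> real \<Rightarrow> complex set \<Rightarrow> bool" where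
  "circle_arc z r A \<longleftrightarrow> (\<exists>s t. s < t \<and> A = path_image (part_circlepath z r s t))"

text \<open>Arcs may repeat: the arcs form an indexed family.\<close>

definition circular_arc_graph :: "'a pair_pre_digraph \<Rightarrow> bool" where
  "circular_arc_graph G \<longleftrightarrow> (\<exists>z r A. r > 0 \<and> (\<forall>v \<in> pverts G. circle_arc z r (A v)) \<and>
     G = intersection_graph (pverts G) A)"

text \<open>
  The line of slope \<open>-1\<close> is \<open>x + y = c\<close>. In the two definitions below \<open>(x, y)\<close> is the bottom,
  respectively left, endpoint of the segment.
\<close>

definition vertical_stick :: "real \<Rightarrow> (real \<times> real) set \<Rightarrow> bool" where
  "vertical_stick c S \<longleftrightarrow> (\<exists>x y y'. x + y = c \<and> y < y' \<and> S = closed_segment (x, y) (x, y'))"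

definition horizontal_stick :: "real \<Rightarrow> (real \<times> real) set \<Rightarrow> bool" where
  "horizontal_stick c S \<longleftrightarrow> (\<exists>x y x'. x + y = c \<and> x < x' \<and> S = closed_segment (x, y) (x', y))"

text \<open>
  Injectivity: the vertices correspond to the elements of a set of segments. Two parallel segments
  may start at the same point of the line; they then intersect, so their vertices are adjacent.
\<close>

definition stick_graph :: "'a pair_pre_digraph \<Rightarrow> bool" where
  "stick_graph G \<longleftrightarrow> (\<exists>c S. inj_on S (pverts G) \<and>
     (\<forall>v \<in> pverts G. vertical_stick c (S v) \<or> horizontal_stick c (S v)) \<and>
     G = intersection_graph (pverts G) S)"

end

theory Submission
  imports Defs
begin

text \<open>
  Cut the circle at a point. An arc becomes an interval \<open>[s, e]\<close>, or wraps around the cut and becomes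
  the complement of \<open>(e, s)\<close>. Since both parts \<open>X\<close>, \<open>Y\<close> of \<open>G\<close> consist of pairwise intersecting
  arcs, among the non-wrapping arcs it cannot happen both that some \<open>x\<close> lies to the left of some
  \<open>y\<close> and that some \<open>y\<close> lies to the left of some \<open>x\<close>. Hence adjacency is a conjunction of two
  conditions, each comparing a real number attached to \<open>x\<close> with one attached to \<open>y\<close>, and
  such a bipartite graph is a Stick graph: the two conditions are the length requirements for a
  vertical and a horizontal stick to meet.
\<close>

section \<open>Arcs as sets of angles\<close>

definition angular_interval :: "real \<Rightarrow> bool \<Rightarrow> real \<Rightarrow> real \<Rightarrow> real set" where
  "angular_interval L w s e = (if w then {0..<L} \<inter> ({..e} \<union> {s..}) else {s..e})"

text \<open>Normal form relative to the cut at 0: for \<open>L > 0\<close>, wrapping intervals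
  contain 0 and the others avoid it. A wrapping interval may have \<open>s = L\<close>, for an arc
  that starts at the cut, or \<open>s \<le> e\<close>, for the whole circle.\<close>

definition proper_endpoints :: "real \<Rightarrow> bool \<Rightarrow> real \<Rightarrow> real \<Rightarrow> bool" where
  "proper_endpoints L w s e \<longleftrightarrow> (if w then 0 \<le> e \<and> s \<le> L else 0 < s \<and> s \<le> e \<and> e < L)"

text \<open>Subtracting whole turns brings the starting angle into [0, 2 pi). The arc then starts at
  angle 0, avoids it, or runs on to it; the first and the last case count as wrapping.\<close>

lemma circle_arc_eq_angular_interval:
  assumes "circle_arc z r A"
  shows "\<exists>w s e. proper_endpoints (2 * pi) w s e \<and>
    A = (\<lambda>\<theta>. z + of_real r * cis \<theta>) ` angular_interval (2 * pi) w s e"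
proof -
  let ?g = "\<lambda>\<theta>. z + of_real r * cis \<theta>"
  have per: "?g (\<theta> + 2 * pi * of_int n) = ?g \<theta>" for \<theta> n
    using cis_mult[of \<theta> "2 * pi * of_int n"] by simp
  obtain s0 t0 where st0: "s0 < t0" and A0: "A = path_image (part_circlepath z r s0 t0)"
    using assms unfolding circle_arc_def by blast
  define n where "n = \<lfloor>s0 / (2 * pi)\<rfloor>"
  define s where "s = s0 - 2 * pi * of_int n"
  define t where "t = t0 - 2 * pi * of_int n"
  have n1: "of_int n \<le> s0 / (2 * pi)" "s0 / (2 * pi) < of_int n + 1"
    unfolding n_def by linarith+
  have s: "0 \<le> s" "s < 2 * pi" "s < t"
    using n1 st0 pi_gt_zero unfolding s_def t_def by (simp_all add: field_simps)
  have "A = ?g ` {s0..t0}"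
    using st0 by (simp add: A0 path_image_part_circlepath' closed_segment_eq_real_ivl)
  also have "\<dots> = ?g ` {s..t}"
  proof (intro equalityI subsetI)
    fix u assume "u \<in> ?g ` {s0..t0}"
    then obtain \<theta> where "\<theta> \<in> {s0..t0}" "u = ?g \<theta>" by blast
    then show "u \<in> ?g ` {s..t}"
      using per[of "\<theta> - 2 * pi * of_int n" n]
      by (intro image_eqI[of _ _ "\<theta> - 2 * pi * of_int n"]) (auto simp: s_def t_def)
  next
    fix u assume "u \<in> ?g ` {s..t}"
    then obtain \<theta> where "\<theta> \<in> {s..t}" "u = ?g \<theta>" by blast
    then show "u \<in> ?g ` {s0..t0}"
      using per[of \<theta> n]
      by (intro image_eqI[of _ _ "\<theta> + 2 * pi * of_int n"]) (auto simp: s_def t_def)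
  qed
  finally have A: "A = ?g ` {s..t}" .
  consider "s = 0" "t < 2 * pi" | "0 < s" "t < 2 * pi" | "2 * pi \<le> t"
    using s by linarith
  then show ?thesis
  proof cases
    case 1
    \<comment> \<open>The start \<open>2 * pi\<close> empties the upper piece and leaves the angles
      from 0 to \<open>t\<close>.\<close>
    then have "{s..t} = angular_interval (2 * pi) True (2 * pi) t"
      using s by (auto simp: angular_interval_def)
    moreover have "proper_endpoints (2 * pi) True (2 * pi) t"
      using 1 s by (simp add: proper_endpoints_def)
    ultimately show ?thesis using A by metis
  next
    case 2
    then have "{s..t} = angular_interval (2 * pi) False s t"
      by (auto simp: angular_interval_def)
    moreover have "proper_endpoints (2 * pi) False s t"
      using 2 s by (simp add: proper_endpoints_def)
    ultimately show ?thesis using A by metis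
  next
    case 3
    have "?g ` {s..t} = ?g ` angular_interval (2 * pi) True s (t - 2 * pi)"
    proof (intro equalityI subsetI)
      fix u assume "u \<in> ?g ` {s..t}"
      then obtain \<theta> where \<theta>: "\<theta> \<in> {s..t}" "u = ?g \<theta>" by blast
      define m where "m = \<lfloor>\<theta> / (2 * pi)\<rfloor>"
      define \<phi> where "\<phi> = \<theta> - 2 * pi * of_int m"
      have m: "of_int m \<le> \<theta> / (2 * pi)" "\<theta> / (2 * pi) < of_int m + 1"
        unfolding m_def by linarith+
      have \<phi>: "0 \<le> \<phi>" "\<phi> < 2 * pi"
        using m pi_gt_zero unfolding \<phi>_def by (simp_all add: field_simps)
      have "\<phi> \<le> t - 2 * pi \<or> s \<le> \<phi>"
      \<comment> \<open>\<open>m\<close> counts the turns removed from \<open>\<theta>\<close>: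
        removing at least one leaves at most \<open>t - 2 * pi\<close>, and otherwise
        \<open>s \<le> \<theta> \<le> \<phi>\<close>.\<close>
      proof (cases "m \<ge> 1")
        case True
        then have "2 * pi * 1 \<le> 2 * pi * of_int m"
          by (intro mult_left_mono) simp_all
        then have "\<phi> \<le> t - 2 * pi"
          using \<theta>(1) unfolding \<phi>_def atLeastAtMost_iff by linarith
        then show ?thesis ..
      next
        case False
        then have "2 * pi * of_int m \<le> 2 * pi * 0"
          by (intro mult_left_mono) simp_all
        then have "s \<le> \<phi>"
          using \<theta>(1) unfolding \<phi>_def atLeastAtMost_iff by linarith
        then show ?thesis ..
      qed
      then have "\<phi> \<in> angular_interval (2 * pi) True s (t - 2 * pi)"
        using \<phi> by (auto simp: angular_interval_def)
      moreover have "u = ?g \<phi>"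
        using per[of \<phi> m] \<theta> by (simp add: \<phi>_def)
      ultimately show "u \<in> ?g ` angular_interval (2 * pi) True s (t - 2 * pi)" by blast
    next
      fix u assume "u \<in> ?g ` angular_interval (2 * pi) True s (t - 2 * pi)"
      then obtain \<phi> where \<phi>: "0 \<le> \<phi>" "\<phi> < 2 * pi" "\<phi> \<le> t - 2 * pi \<or> s \<le> \<phi>" "u = ?g \<phi>"
        by (auto simp: angular_interval_def)
      have u: "u = ?g (\<phi> + 2 * pi)" using \<phi>(4) per[of \<phi> 1, symmetric] by simp
      show "u \<in> ?g ` {s..t}"
      proof (cases "s \<le> \<phi>")
        case True
        then show ?thesis using \<phi> 3 by auto
      next
        case False
        then show ?thesis using \<phi> s u
          by (intro image_eqI[of _ _ "\<phi> + 2 * pi"]) auto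
      qed
    qed
    moreover have "proper_endpoints (2 * pi) True s (t - 2 * pi)"
      using 3 s by (simp add: proper_endpoints_def)
    ultimately show ?thesis using A by metis
  qed
qed

text \<open>An injective map commutes with intersections, so disjointness of arcs can be tested on
  their angles.\<close>

lemma inj_on_circle_point:
  assumes "r > 0"
  shows "inj_on (\<lambda>\<theta>. z + of_real r * cis \<theta>) {0..<2 * pi}"
proof (rule inj_onI)
  fix a b assume *: "a \<in> {0..<2 * pi}" "b \<in> {0..<2 * pi}"
    "z + of_real r * cis a = z + of_real r * cis b"
  then have "cis a = cis b" using assms by simp
  then have "sin a = sin b \<and> cos a = cos b" by (metis cis.simps)
  then obtain n :: int where n: "a = b + 2 * pi * of_int n"
    unfolding sin_cos_eq_iff by blast
  have "2 * pi * \<bar>of_int n\<bar> = \<bar>a - b\<bar>"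
    using n by (simp add: abs_mult)
  also have "\<dots> < 2 * pi * 1" using *(1,2) by (simp add: abs_less_iff)
  finally have "\<bar>of_int n\<bar> < (1::real)" by simp
  then have "n = 0" by linarith
  then show "a = b" using n by simp
qed

lemma angular_interval_subset:
  "proper_endpoints L w s e \<Longrightarrow> angular_interval L w s e \<subseteq> {0..<L}"
  by (auto simp: angular_interval_def proper_endpoints_def split: if_splits)

section \<open>Disjointness as two comparisons\<close>

text \<open>Each inequality alone is a Ferrers relation: a chain graph, with nested neighbourhoods.
  Since the two run in opposite directions, exchanging \<open>X\<close> and \<open>Y\<close> only
  renames the functions. For sticks, the first will say that the vertical one reaches high enough,
  the second that the horizontal one reaches far enough to the right.\<close>

definition two_thresholds :: "'a set \<Rightarrow> 'b set \<Rightarrow> ('a \<Rightarrow> 'b \<Rightarrow> bool) \<Rightarrow> bool" where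
  "two_thresholds X Y R \<longleftrightarrow> (\<exists>f g h k. \<forall>x\<in>X. \<forall>y\<in>Y. R x y \<longleftrightarrow>
     f y < (g x :: real) \<and> h x < (k y :: real))"

lemma two_thresholds_swap:
  "two_thresholds Y X (\<lambda>y x. R x y) \<Longrightarrow> two_thresholds X Y R"
  unfolding two_thresholds_def
proof (elim exE)
  fix f g h k
  assume "\<forall>y\<in>Y. \<forall>x\<in>X. R x y \<longleftrightarrow> f x < (g y :: real) \<and> h y < (k x :: real)"
  then show "\<exists>f g h k. \<forall>x\<in>X. \<forall>y\<in>Y. R x y \<longleftrightarrow> f y < (g x :: real) \<and> h x < (k y :: real)"
    by (intro exI[of _ h] exI[of _ k] exI[of _ f] exI[of _ g]) auto
qed

text \<open>
  Adding \<open>L\<close> to the endpoint of the wrapping intervals of \<open>X\<close> and to the start of the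
  non-wrapping intervals of \<open>Y\<close> makes the second inequality vacuous on non-wrapping pairs and
  false on wrapping pairs.
\<close>

lemma two_thresholds_if_no_left:
  assumes X: "\<And>x. x \<in> X \<Longrightarrow> proper_endpoints L (w x) (s x) (e x)"
    and Y: "\<And>y. y \<in> Y \<Longrightarrow> proper_endpoints L (w y) (s y) (e y)"
    and L: "0 < L"
    and no_left: "\<And>x y. \<lbrakk>x \<in> X; y \<in> Y; \<not> w x; \<not> w y\<rbrakk> \<Longrightarrow> s y \<le> e x"
  shows "two_thresholds X Y (\<lambda>x y. angular_interval L (w x) (s x) (e x) \<inter>
    angular_interval L (w y) (s y) (e y) = {})"
proof -
  let ?T = "\<lambda>v. angular_interval L (w v) (s v) (e v)"
  have disjoint_iff: "?T x \<inter> ?T y = {} \<longleftrightarrow> e y < s x \<and>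
      (if w x then e x + L else e x) < (if w y then s y else s y + L)"
    if xy: "x \<in> X" "y \<in> Y" for x y
  proof -
    note p = X[OF xy(1)] Y[OF xy(2)]
    have mixed: "({0..<L} \<inter> ({..b} \<union> {a..})) \<inter> {c..d} = {} \<longleftrightarrow> b < c \<and> d < a"
      if "0 < c" "c \<le> d" "d < L" for a b c d
    proof
      assume *: "({0..<L} \<inter> ({..b} \<union> {a..})) \<inter> {c..d} = {}"
      \<comment> \<open>Testing the endpoints suffices: \<open>c\<close> and \<open>d\<close> lie in
        [0, L), so both must lie strictly between \<open>b\<close> and \<open>a\<close>.\<close>
      have "c \<notin> ({0..<L} \<inter> ({..b} \<union> {a..})) \<inter> {c..d}"
        "d \<notin> ({0..<L} \<inter> ({..b} \<union> {a..})) \<inter> {c..d}" unfolding * by simp_all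
      then show "b < c \<and> d < a" using that by auto
    qed (use that in auto)
    consider "w x" "w y" | "w x" "\<not> w y" | "\<not> w x" "w y" | "\<not> w x" "\<not> w y" by blast
    then show ?thesis
    proof cases
      case 1
      then have "0 \<in> ?T x \<inter> ?T y" using p L
        by (simp add: angular_interval_def proper_endpoints_def)
      moreover have "\<not> e x + L < s y" using 1 p by (simp add: proper_endpoints_def)
      ultimately show ?thesis using 1 by auto
    next
      case 2
      then show ?thesis using p mixed[of "s y" "e y" "e x" "s x"]
        by (auto simp add: angular_interval_def proper_endpoints_def)
    next
      case 3
      then show ?thesis using p mixed[of "s x" "e x" "e y" "s y"]
        by (auto simp add: angular_interval_def proper_endpoints_def Int_commute)
    next
      case 4
      \<comment> \<open>The intervals can now be disjoint only if that of \<open>y\<close> ends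
        before that of \<open>x\<close> begins, which is the first inequality. The second holds
        because \<open>e x < L < s y + L\<close>.\<close>
      have "s y \<le> e x" using no_left xy 4 by blast
      then show ?thesis using 4 p
        by (auto simp add: angular_interval_def proper_endpoints_def)
    qed
  qed
  show ?thesis unfolding two_thresholds_def
    by (rule exI[of _ e], rule exI[of _ s], rule exI[of _ "\<lambda>x. if w x then e x + L else e x"],
        rule exI[of _ "\<lambda>y. if w y then s y else s y + L"], intro ballI, rule disjoint_iff)
qed

lemma two_thresholds_disjoint_angular_intervals:
  assumes X: "\<And>x. x \<in> X \<Longrightarrow> proper_endpoints L (w x) (s x) (e x)"
    and Y: "\<And>y. y \<in> Y \<Longrightarrow> proper_endpoints L (w y) (s y) (e y)"
    and L: "0 < L"
    and T: "\<And>v. T v = angular_interval L (w v) (s v) (e v)"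
    and meetX: "\<And>x x'. \<lbrakk>x \<in> X; x' \<in> X\<rbrakk> \<Longrightarrow> T x \<inter> T x' \<noteq> {}"
    and meetY: "\<And>y y'. \<lbrakk>y \<in> Y; y' \<in> Y\<rbrakk> \<Longrightarrow> T y \<inter> T y' \<noteq> {}"
  shows "two_thresholds X Y (\<lambda>x y. T x \<inter> T y = {})"
proof (cases "\<forall>x\<in>X. \<forall>y\<in>Y. \<not> w x \<longrightarrow> \<not> w y \<longrightarrow> s y \<le> e x")
  case True
  then show ?thesis unfolding T
    by (intro two_thresholds_if_no_left[OF X Y L]) auto
next
  case False
  then obtain x y where xy: "x \<in> X" "y \<in> Y" "\<not> w x" "\<not> w y" "e x < s y" by force
  \<comment> \<open>One pair with \<open>x\<close> to the left of \<open>y\<close> rules out every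
    pair the other way round: \<open>x'\<close> begins before \<open>x\<close> ends, and
    \<open>y'\<close> ends after \<open>y\<close> begins. So the previous lemma applies with
    \<open>X\<close> and \<open>Y\<close> exchanged.\<close>
  have "s x' \<le> e y'" if "x' \<in> X" "y' \<in> Y" "\<not> w x'" "\<not> w y'" for x' y'
  proof -
    have "s x' \<le> e x" using meetX[of x x'] that xy by (auto simp: T angular_interval_def)
    also have "\<dots> < s y" by (rule xy)
    also have "s y \<le> e y'" using meetY[of y y'] that xy by (auto simp: T angular_interval_def)
    finally show ?thesis by simp
  qed
  then have "two_thresholds Y X (\<lambda>y x. T y \<inter> T x = {})"
    unfolding T by (intro two_thresholds_if_no_left[OF Y X L]) auto
  then show ?thesis by (subst Int_commute) (rule two_thresholds_swap)
qed

section \<open>From two comparisons to sticks\<close>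

text \<open>Ranks with ties broken: parallel sticks must start at distinct points.\<close>

lemma injective_rank:
  fixes f :: "'a \<Rightarrow> real" and g :: "'b \<Rightarrow> real"
  assumes "finite Y"
  shows "\<exists>(q :: 'a \<Rightarrow> nat) (m :: 'b \<Rightarrow> nat). inj_on q Y \<and> (\<forall>x. \<forall>y\<in>Y. f y < g x \<longleftrightarrow> q y < m x)"
proof -
  obtain i :: "'a \<Rightarrow> nat" where i: "inj_on i Y"
    using finite_imp_inj_to_nat_seg[OF assms] by blast
  define B where "B y = {y' \<in> Y. f y' < f y \<or> (f y' = f y \<and> i y' < i y)}" for y
  have mono: "card (B y) < card (B y')"
    if "y \<in> Y" "f y < f y' \<or> (f y = f y' \<and> i y < i y')" for y y'
  proof (rule psubset_card_mono)
    show "finite (B y')" using assms by (simp add: B_def)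
    have "y \<in> B y'" "y \<notin> B y" using that by (auto simp: B_def)
    moreover have "B y \<subseteq> B y'" using that by (auto simp: B_def)
    ultimately show "B y \<subset> B y'" by blast
  qed
  have "inj_on (\<lambda>y. card (B y)) Y"
  proof (rule inj_onI, rule ccontr)
    fix y y' assume *: "y \<in> Y" "y' \<in> Y" "card (B y) = card (B y')" "y \<noteq> y'"
    then have "i y \<noteq> i y'" using i by (auto dest: inj_onD)
    then show False using mono[of y y'] mono[of y' y] * by force
  qed
  \<comment> \<open>The elements with \<open>f\<close>-value below \<open>g x\<close> form an
    initial segment of the order by \<open>f\<close> and then \<open>i\<close>. Its size is
    therefore a threshold for the ranks \<open>card (B y)\<close>.\<close>
  moreover have "f y < g x \<longleftrightarrow> card (B y) < card {y \<in> Y. f y < g x}" if "y \<in> Y" for x y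
  proof (cases "f y < g x")
    case True
    have "y \<in> {y \<in> Y. f y < g x}" "y \<notin> B y" using True that by (auto simp: B_def)
    moreover have "B y \<subseteq> {y \<in> Y. f y < g x}" using True by (auto simp: B_def)
    ultimately have "B y \<subset> {y \<in> Y. f y < g x}" by blast
    then show ?thesis using True assms by (simp add: psubset_card_mono)
  next
    case False
    then have "{y \<in> Y. f y < g x} \<subseteq> B y" by (auto simp: B_def)
    then have "card {y \<in> Y. f y < g x} \<le> card (B y)"
      using assms by (intro card_mono) (simp_all add: B_def)
    then show ?thesis using False by simp
  qed
  ultimately show ?thesis
    by (intro exI[of _ "\<lambda>y. card (B y)"] exI[of _ "\<lambda>x. card {y \<in> Y. f y < g x}"]) simp
qed

lemma vertical_segment:
  fixes x y y' :: real
  assumes "y \<le> y'"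
  shows "closed_segment (x, y) (x, y') = {x} \<times> {y..y'}"
  using assms by (simp add: closed_segment_same_fst closed_segment_eq_real_ivl)

lemma horizontal_segment:
  fixes x x' y :: real
  assumes "x \<le> x'"
  shows "closed_segment (x, y) (x', y) = {x..x'} \<times> {y}"
  using assms by (simp add: closed_segment_same_snd closed_segment_eq_real_ivl)

text \<open>
  All horizontal sticks start to the left of all vertical ones; the halves turn the strict
  comparisons of ranks into weak ones.
\<close>

lemma stick_graph_if_two_thresholds:
  fixes G :: "'a pair_pre_digraph"
  assumes fin: "finite X" "finite Y" and V: "pverts G = X \<union> Y" and XY: "X \<inter> Y = {}"
    and thr: "two_thresholds X Y (\<lambda>x y. (x, y) \<in> parcs G)"
    and bip: "\<And>u v. (u, v) \<in> parcs G \<Longrightarrow> u \<in> X \<and> v \<in> Y \<or> u \<in> Y \<and> v \<in> X"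
    and sym: "\<And>u v. (u, v) \<in> parcs G \<Longrightarrow> (v, u) \<in> parcs G"
  shows "stick_graph G"
proof -
  obtain f g h k where R: "\<And>x y. \<lbrakk>x \<in> X; y \<in> Y\<rbrakk> \<Longrightarrow> (x, y) \<in> parcs G \<longleftrightarrow>
      f y < (g x :: real) \<and> h x < (k y :: real)"
    using thr unfolding two_thresholds_def by blast
  obtain q m :: "'a \<Rightarrow> nat" where q: "inj_on q Y" "\<And>x y. y \<in> Y \<Longrightarrow> f y < g x \<longleftrightarrow> q y < m x"
    using injective_rank[OF fin(2), of f g] by blast
  obtain p n :: "'a \<Rightarrow> nat" where p: "inj_on p X" "\<And>x y. x \<in> X \<Longrightarrow> h x < k y \<longleftrightarrow> p x < n y"
    using injective_rank[OF fin(1), of h k] by blast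
  \<comment> \<open>The line is x + y = 0. The shift by 1 gives vertical sticks a positive abscissa,
    while horizontal ones start at abscissa at most 0; it also keeps a vertical stick of positive
    length when \<open>m v = 0\<close>.\<close>
  define S :: "'a \<Rightarrow> (real \<times> real) set" where
    "S v = (if v \<in> X then {real (p v) + 1} \<times> {- (real (p v) + 1)..real (m v) - 1/2}
            else {- real (q v)..real (n v) + 1/2} \<times> {real (q v)})" for v
  have SX: "S v = {real (p v) + 1} \<times> {- (real (p v) + 1)..real (m v) - 1/2}" if "v \<in> X" for v
    using that by (simp add: S_def)
  have SY: "S v = {- real (q v)..real (n v) + 1/2} \<times> {real (q v)}" if "v \<in> Y" for v
    using that XY by (auto simp: S_def)
  have ne: "S v \<noteq> {}" for v
    by (auto simp: S_def)
  have disjX: "S u \<inter> S v = {}" if "u \<in> X" "v \<in> X" "u \<noteq> v" for u v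
    using that inj_onD[OF p(1), of u v] by (auto simp: SX)
  have disjY: "S u \<inter> S v = {}" if "u \<in> Y" "v \<in> Y" "u \<noteq> v" for u v
    using that inj_onD[OF q(1), of u v] by (auto simp: SY)
  have meet: "S x \<inter> S y \<noteq> {} \<longleftrightarrow> (x, y) \<in> parcs G" if "x \<in> X" "y \<in> Y" for x y
  proof -
    \<comment> \<open>The lines carrying the two sticks cross only at this point. Both sticks start
      before it, so only their far ends matter.\<close>
    have "S x \<inter> S y \<noteq> {} \<longleftrightarrow> (real (p x) + 1, real (q y)) \<in> S x \<inter> S y"
      unfolding SX[OF that(1)] SY[OF that(2)] by blast
    also have "\<dots> \<longleftrightarrow> real (p x) + 1 \<le> real (n y) + 1/2 \<and> real (q y) \<le> real (m x) - 1/2"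
      unfolding SX[OF that(1)] SY[OF that(2)] by auto
    also have "real (p x) + 1 \<le> real (n y) + 1/2 \<longleftrightarrow> p x < n y" by linarith
    also have "real (q y) \<le> real (m x) - 1/2 \<longleftrightarrow> q y < m x" by linarith
    finally show ?thesis using that by (auto simp: R p(2) q(2))
  qed
  have diff: "S x \<noteq> S y" if "x \<in> X" "y \<in> Y" for x y
  proof
    assume eq: "S x = S y"
    \<comment> \<open>These two points of the horizontal stick have different abscissae, whereas a
      vertical stick has only one.\<close>
    have "(- real (q y), real (q y)) \<in> S y" "(real (n y) + 1/2, real (q y)) \<in> S y"
      using that by (auto simp: SY)
    then show False using that unfolding eq[symmetric] by (auto simp: SX)
  qed
  have "inj_on S (pverts G)"
  proof (rule inj_onI, rule ccontr)
    fix u v assume *: "u \<in> pverts G" "v \<in> pverts G" "S u = S v" "u \<noteq> v"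
    then have "S u \<inter> S v \<noteq> {}" using ne by simp
    then have "u \<in> X \<and> v \<in> Y \<or> u \<in> Y \<and> v \<in> X"
      using * disjX[of u v] disjY[of u v] V by blast
    then show False using diff[of u v] diff[of v u] * by auto
  qed
  moreover have "vertical_stick 0 (S v) \<or> horizontal_stick 0 (S v)" if "v \<in> pverts G" for v
  proof (cases "v \<in> X")
    case True
    have "- (real (p v) + 1) < real (m v) - 1/2" by linarith
    then have "vertical_stick 0 (S v)"
      unfolding vertical_stick_def SX[OF True]
      by (intro exI[of _ "real (p v) + 1"] exI[of _ "- (real (p v) + 1)"]
          exI[of _ "real (m v) - 1/2"]) (subst vertical_segment; simp)
    then show ?thesis ..
  next
    case False
    then have "v \<in> Y" using that V by blast
    have "- real (q v) < real (n v) + 1/2" by linarith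
    then have "horizontal_stick 0 (S v)"
      unfolding horizontal_stick_def SY[OF \<open>v \<in> Y\<close>]
      by (intro exI[of _ "- real (q v)"] exI[of _ "real (q v)"]
          exI[of _ "real (n v) + 1/2"]) (subst horizontal_segment; simp)
    then show ?thesis ..
  qed
  moreover have "G = intersection_graph (pverts G) S"
  proof -
    have "(u, v) \<in> parcs G \<longleftrightarrow> u \<in> pverts G \<and> v \<in> pverts G \<and> u \<noteq> v \<and> S u \<inter> S v \<noteq> {}" for u v
    proof
      assume "(u, v) \<in> parcs G"
      then show "u \<in> pverts G \<and> v \<in> pverts G \<and> u \<noteq> v \<and> S u \<inter> S v \<noteq> {}"
        using bip[of u v] sym[of u v] meet[of u v] meet[of v u] V XY
        by (auto simp: Int_commute)
    next
      assume *: "u \<in> pverts G \<and> v \<in> pverts G \<and> u \<noteq> v \<and> S u \<inter> S v \<noteq> {}"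
      then have "u \<in> X \<and> v \<in> Y \<or> u \<in> Y \<and> v \<in> X"
        using disjX disjY V by blast
      then show "(u, v) \<in> parcs G"
        using * meet[of u v] meet[of v u] sym[of v u] by (auto simp: Int_commute)
    qed
    then have "parcs G = {(u, v). u \<in> pverts G \<and> v \<in> pverts G \<and> u \<noteq> v \<and> S u \<inter> S v \<noteq> {}}"
      by auto
    then show ?thesis by (cases G) (simp add: intersection_graph_def)
  qed
  ultimately show ?thesis unfolding stick_graph_def by blast
qed

section \<open>From the arc model of the complement to sticks\<close>

theorem theorem1:
  fixes G :: "'a pair_pre_digraph"
  assumes "pair_graph G"
    and "bipartite G"
    and "circular_arc_graph (complement_graph G)"
  shows "stick_graph G"
proof -
  have fin: "finite (pverts G)"
    using assms(1)
    by (meson pair_digraph.axioms(1) pair_fin_digraph.pair_finite_verts pair_graph.axioms(1))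
  have symm: "(v, u) \<in> parcs G" if "(u, v) \<in> parcs G" for u v
    using assms(1) that
    by (meson pair_graph.axioms(2) pair_pseudo_graph.axioms(2) pair_sym_digraph.arcs_symmetric)
  obtain X Y where V: "pverts G = X \<union> Y" and XY: "X \<inter> Y = {}"
    and "\<forall>(u, v) \<in> parcs G. u \<in> X \<and> v \<in> Y \<or> u \<in> Y \<and> v \<in> X"
    using assms(2) unfolding bipartite_def by (elim exE conjE)
  then have bip: "u \<in> X \<and> v \<in> Y \<or> u \<in> Y \<and> v \<in> X" if "(u, v) \<in> parcs G" for u v
    using that by fast
  have verts: "pverts (complement_graph G) = pverts G"
    by (simp add: complement_graph_def)
  obtain z r A where r: "r > 0" and arcs: "\<forall>v\<in>pverts G. circle_arc z r (A v)"
    and eq: "complement_graph G = intersection_graph (pverts G) A"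
    using assms(3) unfolding circular_arc_graph_def verts by (elim exE conjE)
  let ?g = "\<lambda>\<theta>. z + of_real r * cis \<theta>"
  have "\<forall>v\<in>pverts G. \<exists>w s e. proper_endpoints (2 * pi) w s e \<and>
      A v = ?g ` angular_interval (2 * pi) w s e"
    using arcs by (auto intro: circle_arc_eq_angular_interval)
  then obtain w s e where wse: "\<And>v. v \<in> pverts G \<Longrightarrow> proper_endpoints (2 * pi) (w v) (s v) (e v)"
    "\<And>v. v \<in> pverts G \<Longrightarrow> A v = ?g ` angular_interval (2 * pi) (w v) (s v) (e v)"
    by metis
  define T where "T v = angular_interval (2 * pi) (w v) (s v) (e v)" for v
  have sub: "T v \<subseteq> {0..<2 * pi}" if "v \<in> pverts G" for v
    unfolding T_def using wse(1)[OF that] by (rule angular_interval_subset)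
  have ne: "T v \<noteq> {}" if "v \<in> pverts G" for v
  proof -
    have "A v \<noteq> {}" using arcs that by (auto simp: circle_arc_def)
    then show ?thesis using wse(2)[OF that] by (auto simp: T_def)
  qed
  have AT: "A u \<inter> A v = {} \<longleftrightarrow> T u \<inter> T v = {}" if "u \<in> pverts G" "v \<in> pverts G" for u v
  proof -
    have "A u \<inter> A v = ?g ` (T u \<inter> T v)"
      using wse(2) that sub inj_on_image_Int[OF inj_on_circle_point[OF r], of "T u" "T v"]
      by (simp add: T_def)
    then show ?thesis by simp
  qed
  have adj: "(u, v) \<in> parcs G \<longleftrightarrow> T u \<inter> T v = {}"
    if "u \<in> pverts G" "v \<in> pverts G" "u \<noteq> v" for u v
  proof -
    have "(u, v) \<in> parcs (complement_graph G) \<longleftrightarrow> (u, v) \<in> parcs (intersection_graph (pverts G) A)"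
      by (simp only: eq)
    then show ?thesis using that AT
      by (simp add: complement_graph_def intersection_graph_def)
  qed
  have "two_thresholds X Y (\<lambda>x y. T x \<inter> T y = {})"
  proof (rule two_thresholds_disjoint_angular_intervals[where L = "2 * pi"])
    \<comment> \<open>Distinct vertices of one part are not adjacent in \<open>G\<close>, so their
      arcs meet; for \<open>x = x'\<close> the claim is that the arc is nonempty.\<close>
    show "T x \<inter> T x' \<noteq> {}" if "x \<in> X" "x' \<in> X" for x x'
      using that adj[of x x'] ne[of x] bip[of x x'] V XY by auto
    show "T y \<inter> T y' \<noteq> {}" if "y \<in> Y" "y' \<in> Y" for y y'
      using that adj[of y y'] ne[of y] bip[of y y'] V XY by auto
  qed (use wse(1) V in \<open>auto simp: T_def\<close>)
  moreover have "(x, y) \<in> parcs G \<longleftrightarrow> T x \<inter> T y = {}" if "x \<in> X" "y \<in> Y" for x y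
    using adj[of x y] that V XY by auto
  ultimately have thr: "two_thresholds X Y (\<lambda>x y. (x, y) \<in> parcs G)"
    by (simp add: two_thresholds_def cong: ball_cong)
  show ?thesis
    by (rule stick_graph_if_two_thresholds[OF _ _ V XY thr bip symm]) (use fin V in simp_all)
qed

end
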